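(* Consider the problem $\phi^*:=\min_{x\in X}\{\phi(x):=f(x)+h(x)\}$, with the Lipschitz constants $L$ (for $f$) and $M$ (for $h$) satisfying $M\ge L$, and let $x^*$ be a solution of it. Suppose that in the AGS algorithm the parameters in the first call to the ProxAG procedure ($k=1$) are set to $$\alpha_t=\frac{2}{t+1},\quad p_t=\frac{t-1}{2},\quad q_t=\frac{7L\,T_1(T_1+1)}{4\nu t},$$ and that the parameters in the $k$-th call ($k>1$) are set to $$p_t\equiv p:=\sqrt{\frac{M}{L}},\quad \alpha_t\equiv\alpha:=\frac{1}{p+1},\quad q_t\equiv0.$$ If the other parameters of the AGS algorithm satisfy $$\gamma_k=\frac{2}{k+1},\quad T_k:=\begin{cases}\left\lceil\sqrt{\dfrac{8M}{7L}}\right\rceil,&k=1,\\[2mm]\left\lceil\dfrac{\ln 3}{-\ln(1-\alpha)}\right\rceil,&k>1,\end{cases}\quad \lambda_k:=\begin{cases}1,&k=1,\\ \dfrac{\gamma_k}{1-(1-\alpha)^{T_k}},&k>1,\end{cases}\quad \beta_k:=\begin{cases}\dfrac{L}{\nu},&k=1,\\ \dfrac{9L\gamma_k}{2\nu k\lambda_k},&k>1,\end{cases}$$ then the numbers of gradient evaluations of $\nabla f$ and $\nabla h$ performed by the AGS algorithm to find an $\varepsilon$-solution of $\min_{x\in X}\phi(x)$ can be bounded by $$N_f:=3\sqrt{\frac{LV(x_0,x^* )}{\nu\varepsilon}}$$ and $$N_h:=(1+\ln 3)N_f\left(\sqrt{\frac{M}{L}}+1\right)\le 7\left(\sqrt{\frac{MV(x_0,x^*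 )}{\nu\varepsilon}}+\sqrt{\frac{LV(x_0,x^* )}{\nu\varepsilon}}\right),$$ respectively.
   Context: Setting. $\|\cdot\|$ is a norm and $\langle\cdot,\cdot\rangle$ the inner product on $\mathbb{R}^n$; $X\subseteq\mathbb{R}^n$ is a closed convex set. $f,h:X\to\mathbb{R}$ are continuously differentiable convex functions and $L,M>0$ are such that, with $l_f(u,x):=f(u)+\langle\nabla f(u),x-u\rangle$ and $l_h(u,x):=h(u)+\langle\nabla h(u),x-u\rangle$, $$0\le f(x)-l_f(u,x)\le\tfrac{L}{2}\|x-u\|^2,\qquad 0\le h(x)-l_h(u,x)\le\tfrac{M}{2}\|x-u\|^2,\qquad\forall x,u\in X.$$ For $\varepsilon>0$, an $\varepsilon$-solution of $\min_{x\in X}\phi(x)$ is a point $\bar x\in X$ with $\phi(\bar x)-\phi^*\le\varepsilon$. Prox-function. $V$ is a prox-function on $X$ with modulus $\nu>0$: there is a (differentiable) function $\pi$, strongly convex with parameter $\nu$ with respect to $\|\cdot\|$, such that $V(x,u)=\pi(u)-\pi(x)-\langle\nabla\pi(x),u-x\rangle$ for $x,u\in X$. Hence $V(x,u)\ge\frac{\nu}{2}\|x-u\|^2$. AGS (accelerated gradient sliding) algorithm. Choose $x_0\in X$ and set $\overline{x}_0=x_0$. For $k=1,\dots,N$: $$\underline{x}_k=(1-\gamma_k)\overline{x}_{k-1}+\gamma_kx_{k-1},\quad g_k(\cdot)=l_f(\underline{x}_k,\cdot),$$ $$(x_k,\tilde x_k)=\mathrm{ProxAG}(g_k,\overline{x}_{k-1},x_{k-1},\lambda_k,\beta_k,T_k),\quad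 \overline{x}_k=(1-\lambda_k)\overline{x}_{k-1}+\lambda_k\tilde x_k.$$ Output $\overline{x}_N$. Procedure $(x^+,\tilde x^+)=\mathrm{ProxAG}(g,\overline{x},x,\lambda,\beta,T)$: set $\tilde u_0=\overline{x}$, $u_0=x$. For $t=1,\dots,T$: $$\underline{u}_t=(1-\lambda)\overline{x}+\lambda(1-\alpha_t)\tilde u_{t-1}+\lambda\alpha_tu_{t-1},$$ $$u_t=\operatorname*{argmin}_{u\in X}\ g(u)+l_h(\underline{u}_t,u)+\beta V(x,u)+(\beta p_t+q_t)V(u_{t-1},u),$$ $$\tilde u_t=(1-\alpha_t)\tilde u_{t-1}+\alpha_tu_t.$$ Output $x^+=u_T$, $\tilde x^+=\tilde u_T$. The parameters $\alpha_t,p_t,q_t$ may depend on the index $k$ of the call. Counting. Each outer iteration $k$ (one call to ProxAG) uses one evaluation of $\nabla f$ (at $\underline{x}_k$); each inner iteration $t$ uses one evaluation of $\nabla h$ (at $\underline{u}_t$) and none of $\nabla f$.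
   Formalization: The number of ∇f evaluations is bounded by N_f rounded up; the bound N_h for ∇h is proved as stated when N_f ≥ 1 and otherwise with N_f rounded up, since the literal real bounds fail (e.g. N_f < 1 would allow no iteration). *)

theory Defs
  imports "HOL-Analysis.Analysis"
begin

text \<open>
  The norm of the problem is an arbitrary norm on \<open>real ^ 'n\<close>, not necessarily the one induced
  by the inner product \<open>\<bullet>\<close>.
\<close>

definition is_norm :: "(real ^ 'n \<Rightarrow> real) \<Rightarrow> bool" where
  "is_norm nrm \<longleftrightarrow>
     (\<forall>x. 0 \<le> nrm x) \<and>
     (\<forall>x. nrm x = 0 \<longleftrightarrow> x = 0) \<and>
     (\<forall>c x. nrm (c *\<^sub>R x) = \<bar>c\<bar> * nrm x) \<and>
     (\<forall>x y. nrm (x + y) \<le> nrm x + nrm y)"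

text \<open>
  Differentiability is taken within \<open>X\<close>. If \<open>X\<close> has empty interior the gradient is not determined
  by the function, so the gradient map is a separate argument.
\<close>

definition has_gradient_on ::
  "(real ^ 'n \<Rightarrow> real) \<Rightarrow> (real ^ 'n \<Rightarrow> real ^ 'n) \<Rightarrow> (real ^ 'n) set \<Rightarrow> bool" where
  "has_gradient_on f gf X \<longleftrightarrow>
     (\<forall>x\<in>X. (f has_derivative (\<lambda>d. gf x \<bullet> d)) (at x within X))"

definition linearization ::
  "(real ^ 'n \<Rightarrow> real) \<Rightarrow> (real ^ 'n \<Rightarrow> real ^ 'n) \<Rightarrow> real ^ 'n \<Rightarrow> real ^ 'n \<Rightarrow> real" where
  "linearization f gf u x = f u + gf u \<bullet> (x - u)"

definition smooth_convex_on ::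
  "(real ^ 'n) set \<Rightarrow> (real ^ 'n \<Rightarrow> real) \<Rightarrow> real \<Rightarrow>
   (real ^ 'n \<Rightarrow> real) \<Rightarrow> (real ^ 'n \<Rightarrow> real ^ 'n) \<Rightarrow> bool" where
  "smooth_convex_on X nrm L f gf \<longleftrightarrow>
     convex_on X f \<and> has_gradient_on f gf X \<and> continuous_on X gf \<and>
     (\<forall>x\<in>X. \<forall>u\<in>X. 0 \<le> f x - linearization f gf u x \<and>
        f x - linearization f gf u x \<le> L / 2 * (nrm (x - u))\<^sup>2)"

definition strongly_convex_on ::
  "(real ^ 'n) set \<Rightarrow> (real ^ 'n \<Rightarrow> real) \<Rightarrow> real \<Rightarrow> (real ^ 'n \<Rightarrow> real) \<Rightarrow> bool" where
  "strongly_convex_on X nrm \<nu> w \<longleftrightarrow>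
     (\<forall>x\<in>X. \<forall>y\<in>X. \<forall>s\<in>{0..1}.
        w ((1 - s) *\<^sub>R x + s *\<^sub>R y)
          \<le> (1 - s) * w x + s * w y - \<nu> / 2 * s * (1 - s) * (nrm (x - y))\<^sup>2)"

definition prox_function ::
  "(real ^ 'n) set \<Rightarrow> (real ^ 'n \<Rightarrow> real) \<Rightarrow> real \<Rightarrow>
   (real ^ 'n \<Rightarrow> real ^ 'n \<Rightarrow> real) \<Rightarrow> bool" where
  "prox_function X nrm \<nu> V \<longleftrightarrow>
     (\<exists>w gw. has_gradient_on w gw X \<and> strongly_convex_on X nrm \<nu> w \<and>
        (\<forall>x\<in>X. \<forall>u\<in>X. V x u = w u - w x - gw x \<bullet> (u - x)))"

definition eps_solution ::
  "(real ^ 'n) set \<Rightarrow> (real ^ 'n \<Rightarrow> real) \<Rightarrow> real \<Rightarrow> real ^ 'n \<Rightarrow> bool" where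
  "eps_solution X \<phi> \<epsilon> x \<longleftrightarrow> x \<in> X \<and> \<phi> x - (INF y\<in>X. \<phi> y) \<le> \<epsilon>"

text \<open>
  \<open>(xp, xtp)\<close> is the output \<open>(x\<^sup>+, \<tilde>x\<^sup>+)\<close> of the inner procedure, \<open>u t\<close> and
  \<open>ut t\<close> are its iterates \<open>u\<^sub>t\<close> and \<open>\<tilde>u\<^sub>t\<close>, and \<open>ul\<close> is the point
  at which the gradient of \<open>h\<close> is evaluated.
\<close>

definition prox_ag ::
  "(real ^ 'n) set \<Rightarrow> (real ^ 'n \<Rightarrow> real) \<Rightarrow> (real ^ 'n \<Rightarrow> real ^ 'n) \<Rightarrow>
   (real ^ 'n \<Rightarrow> real ^ 'n \<Rightarrow> real) \<Rightarrow>
   (nat \<Rightarrow> real) \<Rightarrow> (nat \<Rightarrow> real) \<Rightarrow> (nat \<Rightarrow> real) \<Rightarrow>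
   (real ^ 'n \<Rightarrow> real) \<Rightarrow> real ^ 'n \<Rightarrow> real ^ 'n \<Rightarrow> real \<Rightarrow> real \<Rightarrow> nat \<Rightarrow>
   real ^ 'n \<Rightarrow> real ^ 'n \<Rightarrow> bool" where
  "prox_ag X h gh V \<alpha> p q g xb x lam \<beta> T xp xtp \<longleftrightarrow>
     (\<exists>u ut. u 0 = x \<and> ut 0 = xb \<and>
        (\<forall>t\<in>{1..T}.
           (let ul = (1 - lam) *\<^sub>R xb + (lam * (1 - \<alpha> t)) *\<^sub>R ut (t - 1)
                       + (lam * \<alpha> t) *\<^sub>R u (t - 1)
            in is_arg_min
                 (\<lambda>v. g v + linearization h gh ul v + \<beta> * V x v
                        + (\<beta> * p t + q t) * V (u (t - 1)) v)
                 (\<lambda>v. v \<in> X) (u t)) \<and>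
           ut t = (1 - \<alpha> t) *\<^sub>R ut (t - 1) + \<alpha> t *\<^sub>R u t) \<and>
        xp = u T \<and> xtp = ut T)"

text \<open>
  \<open>ags_run\<close> describes the sequences \<open>x k\<close> and \<open>xb k\<close> (the averaged points, which are the
  outputs) generated from \<open>x0\<close>. The parameters do not depend on the total number \<open>N\<close> of outer
  iterations, so the output of the method after \<open>N\<close> outer iterations is \<open>xb N\<close>.
\<close>

definition ags_run ::
  "(real ^ 'n) set \<Rightarrow> (real ^ 'n \<Rightarrow> real) \<Rightarrow> (real ^ 'n \<Rightarrow> real ^ 'n) \<Rightarrow>
   (real ^ 'n \<Rightarrow> real) \<Rightarrow> (real ^ 'n \<Rightarrow> real ^ 'n) \<Rightarrow>
   (real ^ 'n \<Rightarrow> real ^ 'n \<Rightarrow> real) \<Rightarrow>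
   (nat \<Rightarrow> real) \<Rightarrow> (nat \<Rightarrow> real) \<Rightarrow> (nat \<Rightarrow> real) \<Rightarrow> (nat \<Rightarrow> nat) \<Rightarrow>
   (nat \<Rightarrow> nat \<Rightarrow> real) \<Rightarrow> (nat \<Rightarrow> nat \<Rightarrow> real) \<Rightarrow> (nat \<Rightarrow> nat \<Rightarrow> real) \<Rightarrow>
   real ^ 'n \<Rightarrow> (nat \<Rightarrow> real ^ 'n) \<Rightarrow> (nat \<Rightarrow> real ^ 'n) \<Rightarrow> bool" where
  "ags_run X f gf h gh V \<gamma> lam \<beta> T \<alpha> p q x0 x xb \<longleftrightarrow>
     x 0 = x0 \<and> xb 0 = x0 \<and>
     (\<forall>k\<ge>1. \<exists>xt.
        (let xl = (1 - \<gamma> k) *\<^sub>R xb (k - 1) + \<gamma> k *\<^sub>R x (k - 1)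
         in prox_ag X h gh V (\<alpha> k) (p k) (q k) (linearization f gf xl)
              (xb (k - 1)) (x (k - 1)) (lam k) (\<beta> k) (T k) (x k) xt) \<and>
        xb k = (1 - lam k) *\<^sub>R xb (k - 1) + lam k *\<^sub>R xt)"

text \<open>
  Gradient evaluations in \<open>N\<close> outer iterations: one of the gradient of \<open>f\<close> per outer iteration,
  one of the gradient of \<open>h\<close> per inner iteration.
\<close>

definition grad_f_evals :: "nat \<Rightarrow> nat" where
  "grad_f_evals N = (\<Sum>k=1..N. 1)"

definition grad_h_evals :: "(nat \<Rightarrow> nat) \<Rightarrow> nat \<Rightarrow> nat" where
  "grad_h_evals T N = (\<Sum>k=1..N. \<Sum>t=1..T k. 1)"

end

theory Submission
  imports Defs
begin

text \<open>One outer iteration gives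
  \<open>\<phi> (xb k) - \<phi> xstar \<le> (1 - \<gamma> k) * (\<phi> (xb (k - 1)) - \<phi> xstar) + D k * (V (x (k - 1)) xstar - V (x k) xstar)\<close>,
  and the parameters are such that \<open>D k * (k * (k + 1) / 2)\<close> is the constant
  \<open>C = 9 * L / (2 * \<nu>)\<close>. Hence \<open>k * (k + 1) / 2 * (\<phi> (xb k) - \<phi> xstar) + C * V (x k) xstar\<close> does not
  increase, and the accuracy \<open>\<epsilon>\<close> is reached as soon as \<open>N * (N + 1) \<ge> Nf\<^sup>2\<close>. Inside one outer
  iteration, the same telescoping works with the three-point inequality for Bregman distances.\<close>

section \<open>First-order calculus on a convex set, along segments\<close>

lemma convex_mem_segment:
  fixes x y :: "real ^ 'n" and s :: real
  assumes "convex X" "x \<in> X" "y \<in> X" "0 \<le> s" "s \<le> 1"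
  shows "(1 - s) *\<^sub>R x + s *\<^sub>R y \<in> X" "x + s *\<^sub>R (y - x) \<in> X"
proof -
  show *: "(1 - s) *\<^sub>R x + s *\<^sub>R y \<in> X" using assms by (simp add: convexD)
  have "x + s *\<^sub>R (y - x) = (1 - s) *\<^sub>R x + s *\<^sub>R y" by (simp add: algebra_simps)
  then show "x + s *\<^sub>R (y - x) \<in> X" using * by simp
qed

text \<open>The derivative is taken only within \<open>X\<close>, so the chain rule is applied to
  the segment from \<open>x\<close> to \<open>y\<close>, which convexity keeps inside
  \<open>X\<close>. This yields a one-sided limit.\<close>

lemma directional_derivative:
  fixes w :: "real ^ 'n \<Rightarrow> real"
  assumes "has_gradient_on w gw X" "convex X" "x \<in> X" "y \<in> X"
  shows "((\<lambda>s. (w (x + s *\<^sub>R (y - x)) - w x) / s) \<longlongrightarrow> gw x \<bullet> (y - x)) (at_right 0)"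
proof -
  let ?l = "\<lambda>s::real. x + s *\<^sub>R (y - x)"
  have sub: "?l ` {0..1} \<subseteq> X"
  proof
    fix v assume "v \<in> ?l ` {0..1}"
    then show "v \<in> X" using convex_mem_segment(2)[OF assms(2-4)] by auto
  qed
  have w: "(w has_derivative (\<lambda>d. gw x \<bullet> d)) (at (?l 0) within ?l ` {0..1})"
    using assms(1,3) has_derivative_subset[OF _ sub] by (auto simp: has_gradient_on_def)
  have l: "(?l has_derivative (\<lambda>s. s *\<^sub>R (y - x))) (at 0 within {0..1})"
    by (auto intro!: derivative_eq_intros)
  have "((\<lambda>s. w (?l s)) has_derivative (\<lambda>s. gw x \<bullet> (s *\<^sub>R (y - x)))) (at 0 within {0..1})"
    by (rule has_derivative_in_compose[OF l w])
  then have "((\<lambda>s. w (?l s)) has_field_derivative gw x \<bullet> (y - x)) (at 0 within {0..1})"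
    by (simp add: has_field_derivative_def mult.commute[of _ "gw x \<bullet> (y - x)"] fun_eq_iff)
  then show ?thesis
    by (simp add: has_field_derivative_iff at_within_Icc_at_right)
qed

text \<open>Divide the strong convexity inequality at \<open>x + s *\<^sub>R (y - x)\<close> by
  \<open>s\<close> and let \<open>s\<close> tend to 0 from the right.\<close>

lemma strongly_convex_gradient_bound:
  fixes w :: "real ^ 'n \<Rightarrow> real"
  assumes "has_gradient_on w gw X" "convex X" "strongly_convex_on X nrm \<nu> w" "x \<in> X" "y \<in> X"
  shows "w x + gw x \<bullet> (y - x) + \<nu> / 2 * (nrm (x - y))\<^sup>2 \<le> w y"
proof -
  let ?b = "\<lambda>s. w y - w x - \<nu> / 2 * (1 - s) * (nrm (x - y))\<^sup>2"
  have "eventually (\<lambda>s::real. s \<in> {0<..<1}) (at_right 0)"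
    by (rule eventually_at_right_real) simp
  then have ev: "eventually (\<lambda>s. (w (x + s *\<^sub>R (y - x)) - w x) / s \<le> ?b s) (at_right 0)"
  proof eventually_elim
    case (elim s)
    have e: "x + s *\<^sub>R (y - x) = (1 - s) *\<^sub>R x + s *\<^sub>R y" by (simp add: algebra_simps)
    have "w (x + s *\<^sub>R (y - x)) \<le> (1 - s) * w x + s * w y - \<nu> / 2 * s * (1 - s) * (nrm (x - y))\<^sup>2"
      using assms(3-5) elim unfolding strongly_convex_on_def e by auto
    then have "w (x + s *\<^sub>R (y - x)) - w x \<le> ?b s * s" by (simp add: algebra_simps)
    then show ?case using elim by (simp add: pos_divide_le_eq)
  qed
  have "(?b \<longlongrightarrow> ?b 0) (at_right 0)" by (intro tendsto_intros)
  from tendsto_le[OF _ this directional_derivative[OF assms(1,2,4,5)] ev] show ?thesis by simp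
qed

text \<open>Minimality is compared with feasible points on the segment towards \<open>z\<close> and
  divided by the step length. The objective has the form that a prox subproblem takes once its
  Bregman terms are expanded.\<close>

lemma gradient_optimality:
  fixes w :: "real ^ 'n \<Rightarrow> real"
  assumes "has_gradient_on w gw X" "convex X" "u \<in> X" "z \<in> X"
    and min: "\<And>v. v \<in> X \<Longrightarrow> a \<bullet> u + \<kappa> * w u \<le> a \<bullet> v + \<kappa> * w v"
  shows "0 \<le> a \<bullet> (z - u) + \<kappa> * (gw u \<bullet> (z - u))"
proof -
  let ?q = "\<lambda>s. a \<bullet> (z - u) + \<kappa> * ((w (u + s *\<^sub>R (z - u)) - w u) / s)"
  have "eventually (\<lambda>s::real. s \<in> {0<..<1}) (at_right 0)"
    by (rule eventually_at_right_real) simp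
  then have ev: "eventually (\<lambda>s. 0 \<le> ?q s) (at_right 0)"
  proof eventually_elim
    case (elim s)
    have "u + s *\<^sub>R (z - u) \<in> X" using assms(2-4) elim by (intro convex_mem_segment) auto
    from min[OF this] have "0 \<le> s * (a \<bullet> (z - u)) + \<kappa> * (w (u + s *\<^sub>R (z - u)) - w u)"
      by (simp add: inner_simps algebra_simps)
    also have "\<dots> = s * ?q s" using elim by (simp add: field_simps)
    finally show ?case using elim by (simp add: zero_le_mult_iff)
  qed
  have "(?q \<longlongrightarrow> a \<bullet> (z - u) + \<kappa> * (gw u \<bullet> (z - u))) (at_right 0)"
    by (intro tendsto_intros directional_derivative[OF assms(1-4)])
  from tendsto_lowerbound[OF this ev] show ?thesis by simp
qed

section \<open>Bregman distances\<close>

text \<open>Fixes the generating function \<open>w\<close> and its gradient map \<open>gw\<close>,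
  which \<open>prox_function\<close> only asserts to exist.\<close>

locale bregman =
  fixes X :: "(real ^ 'n) set" and nrm :: "real ^ 'n \<Rightarrow> real" and \<nu> :: real
    and w :: "real ^ 'n \<Rightarrow> real" and gw :: "real ^ 'n \<Rightarrow> real ^ 'n"
    and V :: "real ^ 'n \<Rightarrow> real ^ 'n \<Rightarrow> real"
  assumes convex_X: "convex X" and norm: "is_norm nrm" and \<nu>: "0 < \<nu>"
    and grad: "has_gradient_on w gw X" and strong: "strongly_convex_on X nrm \<nu> w"
    and V_eq: "\<And>x u. x \<in> X \<Longrightarrow> u \<in> X \<Longrightarrow> V x u = w u - w x - gw x \<bullet> (u - x)"
begin

lemma nrm_scale: "nrm (c *\<^sub>R v) = \<bar>c\<bar> * nrm v"
  using norm by (simp add: is_norm_def)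

lemma nrm_commute: "nrm (x - y) = nrm (y - x)"
  using nrm_scale[of "-1" "x - y"] by simp

lemma V_ge: "x \<in> X \<Longrightarrow> u \<in> X \<Longrightarrow> \<nu> / 2 * (nrm (u - x))\<^sup>2 \<le> V x u"
  using strongly_convex_gradient_bound[OF grad convex_X strong] by (force simp: V_eq nrm_commute[of u x])

lemma V_nonneg: "x \<in> X \<Longrightarrow> u \<in> X \<Longrightarrow> 0 \<le> V x u"
  using V_ge[of x u] \<nu> by (meson divide_nonneg_nonneg less_imp_le mult_nonneg_nonneg order_trans zero_le_numeral zero_le_power2)

lemma V_eq_0_D:
  assumes "x \<in> X" "u \<in> X" "V x u = 0"
  shows "u = x"
proof -
  have "\<nu> / 2 * (nrm (u - x))\<^sup>2 \<le> 0" using V_ge[OF assms(1,2)] assms(3) by simp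
  then have "nrm (u - x) = 0" using \<nu> by (simp add: mult_le_0_iff)
  then show ?thesis using norm by (simp add: is_norm_def)
qed

text \<open>\<open>V x\<close> differs from \<open>w\<close> by an affine function. It serves to
  merge the terms \<open>V x (u t)\<close> of the inner iterates into one at their weighted
  mean.\<close>

lemma V_convex:
  assumes "x \<in> X" "a \<in> X" "b \<in> X" "0 \<le> s" "s \<le> 1"
  shows "V x ((1 - s) *\<^sub>R a + s *\<^sub>R b) \<le> (1 - s) * V x a + s * V x b"
proof -
  let ?c = "(1 - s) *\<^sub>R a + s *\<^sub>R b"
  have c: "?c \<in> X" using convex_mem_segment[OF convex_X assms(2-5)] by simp
  have "w ?c \<le> (1 - s) * w a + s * w b - \<nu> / 2 * s * (1 - s) * (nrm (a - b))\<^sup>2"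
    using strong assms by (simp add: strongly_convex_on_def)
  moreover have "0 \<le> \<nu> / 2 * s * (1 - s) * (nrm (a - b))\<^sup>2" using \<nu> assms by simp
  ultimately have "w ?c \<le> (1 - s) * w a + s * w b" by simp
  then show ?thesis using assms c by (simp add: V_eq inner_simps algebra_simps)
qed

text \<open>By \<open>V_eq\<close> the objective is affine plus \<open>(\<beta> + c) * w\<close>.
  The first-order condition at \<open>u\<close>, rewritten through \<open>V_eq\<close>, produces the
  extra term \<open>(\<beta> + c) * V u z\<close>.\<close>

lemma three_point:
  assumes min: "is_arg_min (\<lambda>v. a0 + a \<bullet> v + \<beta> * V x v + c * V y v) (\<lambda>v. v \<in> X) u"
    and "x \<in> X" "y \<in> X" "z \<in> X"
  shows "a \<bullet> u + \<beta> * V x u + c * V y u + (\<beta> + c) * V u z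
           \<le> a \<bullet> z + \<beta> * V x z + c * V y z"
proof -
  let ?a = "a - \<beta> *\<^sub>R gw x - c *\<^sub>R gw y"
  have u: "u \<in> X" using min by (simp add: is_arg_min_def)
  have "?a \<bullet> u + (\<beta> + c) * w u \<le> ?a \<bullet> v + (\<beta> + c) * w v" if v: "v \<in> X" for v
  proof -
    have "a \<bullet> u + \<beta> * V x u + c * V y u \<le> a \<bullet> v + \<beta> * V x v + c * V y v"
      using min v by (fastforce simp: is_arg_min_linorder)
    then show ?thesis using u v assms by (simp add: V_eq inner_simps algebra_simps)
  qed
  from gradient_optimality[OF grad convex_X u \<open>z \<in> X\<close> this]
  show ?thesis using u assms by (simp add: V_eq inner_simps algebra_simps)
qed

section \<open>Estimates for an inner iteration, a call of the procedure and an outer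
  iteration\<close>

text \<open>Here \<open>c\<close> stands for \<open>\<beta> * p t + q t\<close>. Its lower bound
  lets \<open>c * V u u'\<close> from the three-point inequality pay for the quadratic error of
  linearizing \<open>h\<close> at \<open>ul\<close>.\<close>

lemma prox_ag_step:
  assumes h: "smooth_convex_on X nrm M h gh"
    and g: "\<And>v. g v = a0 + a \<bullet> v"
    and mem: "xb \<in> X" "x \<in> X" "ut \<in> X" "u \<in> X" "z \<in> X"
    and lam: "0 \<le> lam" "lam \<le> 1" and \<alpha>: "0 < \<alpha>" "\<alpha> \<le> 1"
    and ul: "ul = (1 - lam) *\<^sub>R xb + (lam * (1 - \<alpha>)) *\<^sub>R ut + (lam * \<alpha>) *\<^sub>R u"
    and min: "is_arg_min (\<lambda>v. g v + linearization h gh ul v + \<beta> * V x v + c * V u v) (\<lambda>v. v \<in> X) u'"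
    and ut': "ut' = (1 - \<alpha>) *\<^sub>R ut + \<alpha> *\<^sub>R u'"
    and c: "lam * M * \<alpha> \<le> \<nu> * c" "0 \<le> c"
  shows "h ((1 - lam) *\<^sub>R xb + lam *\<^sub>R ut') + lam * g ut'
     \<le> (1 - \<alpha>) * (h ((1 - lam) *\<^sub>R xb + lam *\<^sub>R ut) + lam * g ut) + \<alpha> * (1 - lam) * h xb
       + lam * \<alpha> * (g z + h z + \<beta> * (V x z - V x u') + c * V u z - (\<beta> + c) * V u' z)"
proof -
  let ?y = "\<lambda>v. (1 - lam) *\<^sub>R xb + lam *\<^sub>R v"
  let ?l = "linearization h gh ul"
  have yX: "?y v \<in> X" if "v \<in> X" for v
    using convex_mem_segment[OF convex_X mem(1) that lam] by simp
  have u': "u' \<in> X" using min by (simp add: is_arg_min_def)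
  have ut'X: "ut' \<in> X" using ut' convex_mem_segment[OF convex_X mem(3) u', of \<alpha>] \<alpha> by simp
  have "ul = ?y ((1 - \<alpha>) *\<^sub>R ut + \<alpha> *\<^sub>R u)" by (simp add: ul algebra_simps)
  then have ulX: "ul \<in> X" using yX convex_mem_segment[OF convex_X mem(3,4), of \<alpha>] \<alpha> by simp
  have l_le: "?l v \<le> h v" if "v \<in> X" for v
    using h ulX that by (fastforce simp: smooth_convex_on_def)
  \<comment> \<open>\<open>ul\<close> is \<open>?y ut'\<close> with \<open>u\<close> in place of
    \<open>u'\<close>, so only the increment of the prox iterate survives.\<close>
  have diff: "?y ut' - ul = (lam * \<alpha>) *\<^sub>R (u' - u)" by (simp add: ul ut' algebra_simps)
  have "M / 2 * (nrm (?y ut' - ul))\<^sup>2 = lam * \<alpha> * (lam * M * \<alpha>) / 2 * (nrm (u' - u))\<^sup>2"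
    unfolding diff nrm_scale by (simp add: power2_eq_square algebra_simps)
  also have "\<dots> \<le> lam * \<alpha> * (\<nu> * c) / 2 * (nrm (u' - u))\<^sup>2"
    using lam \<alpha> c by (intro mult_right_mono divide_right_mono mult_left_mono) auto
  also have "\<dots> = lam * \<alpha> * c * (\<nu> / 2 * (nrm (u' - u))\<^sup>2)" by simp
  also have "\<dots> \<le> lam * \<alpha> * c * V u u'"
    using lam \<alpha> c mem u' by (intro mult_left_mono V_ge) auto
  finally have quad: "M / 2 * (nrm (?y ut' - ul))\<^sup>2 \<le> lam * \<alpha> * c * V u u'" .
  have "h (?y ut') - ?l (?y ut') \<le> M / 2 * (nrm (?y ut' - ul))\<^sup>2"
    using h ulX yX[OF ut'X] by (auto simp: smooth_convex_on_def)
  then have 1: "h (?y ut') \<le> ?l (?y ut') + lam * \<alpha> * c * V u u'" using quad by simp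
  \<comment> \<open>\<open>?y ut'\<close> is the combination of \<open>?y ut\<close>,
    \<open>xb\<close> and \<open>u'\<close> with these weights, which sum to 1, and
    \<open>?l\<close> is affine.\<close>
  have 2: "?l (?y ut') = (1 - \<alpha>) * ?l (?y ut) + \<alpha> * (1 - lam) * ?l xb + lam * \<alpha> * ?l u'"
    by (simp add: linearization_def ut' inner_simps algebra_simps)
  have 3: "(1 - \<alpha>) * ?l (?y ut) \<le> (1 - \<alpha>) * h (?y ut)" "\<alpha> * (1 - lam) * ?l xb \<le> \<alpha> * (1 - lam) * h xb"
    using \<alpha> lam by (auto intro!: mult_left_mono l_le yX mem)
  have "is_arg_min (\<lambda>v. (a0 + h ul - gh ul \<bullet> ul) + (a + gh ul) \<bullet> v + \<beta> * V x v + c * V u v) (\<lambda>v. v \<in> X) u'"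
    using min by (simp add: g linearization_def inner_simps algebra_simps)
  from three_point[OF this mem(2,4,5)]
  have "g u' + ?l u' + \<beta> * V x u' + c * V u u' + (\<beta> + c) * V u' z \<le> g z + ?l z + \<beta> * V x z + c * V u z"
    by (simp add: g linearization_def inner_simps algebra_simps)
  then have "g u' + ?l u' + c * V u u' \<le> g z + h z + \<beta> * (V x z - V x u') + c * V u z - (\<beta> + c) * V u' z"
    using l_le[OF mem(5)] by (simp add: algebra_simps)
  then have 4: "lam * \<alpha> * (g u' + ?l u' + c * V u u')
    \<le> lam * \<alpha> * (g z + h z + \<beta> * (V x z - V x u') + c * V u z - (\<beta> + c) * V u' z)"
    using lam \<alpha> by (intro mult_left_mono) auto
  have 5: "lam * g ut' = (1 - \<alpha>) * (lam * g ut) + lam * \<alpha> * g u'"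
    by (simp add: g ut' inner_simps algebra_simps)
  have 6: "lam * \<alpha> * (g u' + ?l u' + c * V u u') = lam * \<alpha> * g u' + lam * \<alpha> * ?l u' + lam * \<alpha> * c * V u u'"
    "(1 - \<alpha>) * (h (?y ut) + lam * g ut) = (1 - \<alpha>) * h (?y ut) + (1 - \<alpha>) * (lam * g ut)"
    by (simp_all add: algebra_simps)
  show ?thesis using 1 2 3 4 5 6 by linarith
qed

text \<open>The recursion \<open>b_Suc\<close> makes the distances to \<open>z\<close> telescope
  with weights \<open>b\<close>. The negative terms \<open>V x (u t)\<close> are kept and combined
  by convexity into one at the weighted mean \<open>v\<close>, for use in the outer step.\<close>

lemma prox_ag_bound:
  assumes h: "smooth_convex_on X nrm M h gh"
    and g: "\<And>v. g v = a0 + a \<bullet> v"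
    and mem: "xb \<in> X" "x \<in> X" "z \<in> X"
    and lam: "0 \<le> lam" "lam \<le> 1" and T: "1 \<le> T"
    and \<alpha>: "\<And>t. 1 \<le> t \<Longrightarrow> 0 < \<alpha> t \<and> \<alpha> t \<le> 1"
    and pq: "\<And>t. 1 \<le> t \<Longrightarrow> lam * M * \<alpha> t \<le> \<nu> * (\<beta> * p t + q t) \<and> 0 \<le> \<beta> * p t + q t"
    and b: "\<And>t. 1 \<le> t \<Longrightarrow> b t = \<alpha> t * (\<beta> * (1 + p t) + q t)"
    and b_Suc: "\<And>t. 1 \<le> t \<Longrightarrow> \<alpha> (Suc t) * (\<beta> * p (Suc t) + q (Suc t)) = (1 - \<alpha> (Suc t)) * b t"
    and \<beta>: "0 \<le> \<beta>"
    and run: "prox_ag X h gh V \<alpha> p q g xb x lam \<beta> T xp xtp"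
  shows "xp \<in> X \<and> xtp \<in> X \<and> (\<exists>v\<in>X. xtp = (\<Prod>i=1..T. 1 - \<alpha> i) *\<^sub>R xb + (1 - (\<Prod>i=1..T. 1 - \<alpha> i)) *\<^sub>R v \<and>
      h ((1 - lam) *\<^sub>R xb + lam *\<^sub>R xtp) - (1 - lam) * h xb + lam * (g xtp - g z - h z)
        \<le> (\<Prod>i=1..T. 1 - \<alpha> i) * (lam * (h xb + g xb - h z - g z))
          + lam * b T * (V x z - V xp z) - lam * \<beta> * (1 - (\<Prod>i=1..T. 1 - \<alpha> i)) * V x v)"
proof -
  define \<Lambda> where "\<Lambda> t = (\<Prod>i=1..t. 1 - \<alpha> i)" for t :: nat
  from run obtain u ut where u0: "u 0 = x" "ut 0 = xb" and end_T: "xp = u T" "xtp = ut T"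
    and step': "\<forall>t\<in>{1..T}. is_arg_min (\<lambda>v. g v + linearization h gh
        ((1 - lam) *\<^sub>R xb + (lam * (1 - \<alpha> t)) *\<^sub>R ut (t - 1) + (lam * \<alpha> t) *\<^sub>R u (t - 1)) v
        + \<beta> * V x v + (\<beta> * p t + q t) * V (u (t - 1)) v) (\<lambda>v. v \<in> X) (u t)
      \<and> ut t = (1 - \<alpha> t) *\<^sub>R ut (t - 1) + \<alpha> t *\<^sub>R u t"
    unfolding prox_ag_def Let_def by blast
  note step = bspec[OF step', unfolded atLeastAtMost_iff, OF conjI]
  \<comment> \<open>Subtracting \<open>(1 - lam) * h xb\<close> and \<open>lam * (g z + h z)\<close>
    turns the inequality of \<open>prox_ag_step\<close> into a contraction by
    \<open>1 - \<alpha> t\<close>, up to Bregman terms.\<close>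
  define E where "E t = h ((1 - lam) *\<^sub>R xb + lam *\<^sub>R ut t) - (1 - lam) * h xb + lam * (g (ut t) - g z - h z)" for t
  have E0: "E 0 = lam * (h xb + g xb - h z - g z)"
    by (simp add: E_def u0 algebra_simps flip: scaleR_add_left)
  have memX: "u t \<in> X \<and> ut t \<in> X" if "t \<le> T" for t
    using that
  proof (induction t)
    case 0 then show ?case using u0 mem by simp
  next
    case (Suc t)
    have "u (Suc t) \<in> X" using step[of "Suc t"] Suc.prems by (simp add: is_arg_min_def)
    moreover have "ut (Suc t) = (1 - \<alpha> (Suc t)) *\<^sub>R ut t + \<alpha> (Suc t) *\<^sub>R u (Suc t)"
      using step[of "Suc t"] Suc.prems by simp
    ultimately show ?case
      using convex_mem_segment(1)[OF convex_X, of "ut t" "u (Suc t)" "\<alpha> (Suc t)"] Suc \<alpha>[of "Suc t"] by simp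
  qed
  have E_step: "E (Suc t) \<le> (1 - \<alpha> (Suc t)) * E t + lam * \<alpha> (Suc t) * (\<beta> * (V x z - V x (u (Suc t)))
      + (\<beta> * p (Suc t) + q (Suc t)) * V (u t) z) - lam * b (Suc t) * V (u (Suc t)) z" if "Suc t \<le> T" for t
  proof -
    note st = step[of "Suc t", simplified, OF that]
    have tX: "u t \<in> X" "ut t \<in> X" using memX[of t] that by auto
    note \<alpha>' = \<alpha>[of "Suc t", simplified] note pq' = pq[of "Suc t", simplified]
    from prox_ag_step[OF h g mem(1,2) tX(2,1) mem(3) lam \<alpha>'[THEN conjunct1] \<alpha>'[THEN conjunct2] refl
        st[THEN conjunct1] st[THEN conjunct2] pq'[THEN conjunct1] pq'[THEN conjunct2]]
    show ?thesis by (simp add: E_def b algebra_simps)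
  qed
  \<comment> \<open>The point \<open>v\<close> carries weight \<open>1 - \<Lambda> t\<close>, which
    is zero at \<open>t = 0\<close>; hence the induction starts at 1.\<close>
  have "\<exists>v\<in>X. ut t = \<Lambda> t *\<^sub>R xb + (1 - \<Lambda> t) *\<^sub>R v \<and> 0 \<le> \<Lambda> t \<and> \<Lambda> t < 1 \<and>
      E t \<le> \<Lambda> t * E 0 + lam * b t * (V x z - V (u t) z) - lam * \<beta> * (1 - \<Lambda> t) * V x v"
    if "1 \<le> t" "t \<le> T" for t
    using that
  proof (induction t rule: nat_induct_at_least)
    case base
    have \<Lambda>1: "\<Lambda> 1 = 1 - \<alpha> 1" by (simp add: \<Lambda>_def)
    have "ut 1 = (1 - \<alpha> 1) *\<^sub>R xb + \<alpha> 1 *\<^sub>R u 1" using step[of 1] base u0 by simp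
    moreover have "E 1 \<le> (1 - \<alpha> 1) * E 0 + lam * b 1 * (V x z - V (u 1) z) - lam * \<beta> * \<alpha> 1 * V x (u 1)"
      using E_step[of 0] base u0 b[of 1] by (simp add: algebra_simps)
    ultimately show ?case using memX[of 1] base \<alpha>[of 1] by (auto simp: \<Lambda>1[simplified])
  next
    case (Suc t)
    let ?\<alpha> = "\<alpha> (Suc t)" and ?u = "u (Suc t)"
    obtain v where v: "v \<in> X" "ut t = \<Lambda> t *\<^sub>R xb + (1 - \<Lambda> t) *\<^sub>R v" "0 \<le> \<Lambda> t" "\<Lambda> t < 1"
      "E t \<le> \<Lambda> t * E 0 + lam * b t * (V x z - V (u t) z) - lam * \<beta> * (1 - \<Lambda> t) * V x v"
      using Suc by auto
    have \<alpha>': "0 < ?\<alpha>" "?\<alpha> \<le> 1" using \<alpha>[of "Suc t"] by auto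
    have \<Lambda>: "\<Lambda> (Suc t) = (1 - ?\<alpha>) * \<Lambda> t" by (simp add: \<Lambda>_def)
    define r where "r = 1 - \<Lambda> (Suc t)"
    have "(1 - ?\<alpha>) * \<Lambda> t \<le> (1 - ?\<alpha>) * 1" using v \<alpha>' by (intro mult_left_mono) auto
    then have r: "0 < r" "?\<alpha> \<le> r" "r \<le> 1" using v \<alpha>' by (auto simp: r_def \<Lambda>)
    \<comment> \<open>The share of the new iterate in the normalized mean: \<open>r\<close> is the
      total weight of the iterates so far and \<open>?\<alpha>\<close> that of the newest.\<close>
    define s where "s = ?\<alpha> / r"
    have rs: "r * s = ?\<alpha>" using r by (simp add: s_def)
    have r1s: "r * (1 - s) = (1 - ?\<alpha>) * (1 - \<Lambda> t)"
      using rs by (simp add: r_def \<Lambda> algebra_simps)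
    have s: "0 \<le> s" "s \<le> 1" using r \<alpha>' by (auto simp: s_def)
    define v' where "v' = (1 - s) *\<^sub>R v + s *\<^sub>R ?u"
    have uX: "?u \<in> X" using memX Suc.prems by blast
    have v'X: "v' \<in> X" unfolding v'_def by (rule convex_mem_segment[OF convex_X v(1) uX s])
    have ut: "ut (Suc t) = \<Lambda> (Suc t) *\<^sub>R xb + r *\<^sub>R v'"
    proof -
      have "r *\<^sub>R v' = (r * (1 - s)) *\<^sub>R v + (r * s) *\<^sub>R ?u" by (simp add: v'_def scaleR_add_right)
      also have "\<dots> = ((1 - ?\<alpha>) * (1 - \<Lambda> t)) *\<^sub>R v + ?\<alpha> *\<^sub>R ?u" by (simp only: rs r1s)
      finally have "r *\<^sub>R v' = ((1 - ?\<alpha>) * (1 - \<Lambda> t)) *\<^sub>R v + ?\<alpha> *\<^sub>R ?u" .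
      then show ?thesis using step[of "Suc t"] Suc.prems by (simp add: v(2) \<Lambda> scaleR_add_right)
    qed
    have "r * V x v' \<le> r * ((1 - s) * V x v + s * V x ?u)"
      unfolding v'_def using r V_convex[OF mem(2) v(1) uX s] by simp
    also have "\<dots> = (r * (1 - s)) * V x v + (r * s) * V x ?u" by (simp add: algebra_simps)
    finally have "r * V x v' \<le> (1 - ?\<alpha>) * (1 - \<Lambda> t) * V x v + ?\<alpha> * V x ?u" by (simp only: rs r1s)
    then have V': "lam * \<beta> * (r * V x v') \<le> lam * \<beta> * ((1 - ?\<alpha>) * (1 - \<Lambda> t) * V x v + ?\<alpha> * V x ?u)"
      using lam \<beta> by (intro mult_left_mono) auto
    \<comment> \<open>The first identity cancels the terms in \<open>V (u t) z\<close> between the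
      induction hypothesis and the new step; the second collects those in
      \<open>V x z\<close>.\<close>
    have bS: "?\<alpha> * (\<beta> * p (Suc t) + q (Suc t)) = (1 - ?\<alpha>) * b t" "b (Suc t) = (1 - ?\<alpha>) * b t + ?\<alpha> * \<beta>"
      using b_Suc[of t] b[of "Suc t"] Suc.hyps by (auto simp: algebra_simps)
    have "E (Suc t) \<le> (1 - ?\<alpha>) * E t + lam * ?\<alpha> * \<beta> * (V x z - V x ?u)
      + lam * (?\<alpha> * (\<beta> * p (Suc t) + q (Suc t))) * V (u t) z - lam * b (Suc t) * V ?u z"
      using E_step[of t] Suc.prems by (simp add: algebra_simps)
    also have "(1 - ?\<alpha>) * E t \<le> (1 - ?\<alpha>) *
        (\<Lambda> t * E 0 + lam * b t * (V x z - V (u t) z) - lam * \<beta> * (1 - \<Lambda> t) * V x v)"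
      using \<alpha>' v(5) by (intro mult_left_mono) auto
    finally have "E (Suc t) \<le> \<Lambda> (Suc t) * E 0 + lam * b (Suc t) * (V x z - V ?u z)
        - lam * \<beta> * ((1 - ?\<alpha>) * (1 - \<Lambda> t) * V x v + ?\<alpha> * V x ?u)"
      unfolding bS \<Lambda> by (simp add: algebra_simps)
    then have "E (Suc t) \<le> \<Lambda> (Suc t) * E 0 + lam * b (Suc t) * (V x z - V ?u z) - lam * \<beta> * r * V x v'"
      using V' by (simp add: mult.assoc)
    moreover have "0 \<le> \<Lambda> (Suc t)" using v \<alpha>' by (simp add: \<Lambda>)
    ultimately show ?case using v'X ut r unfolding r_def by auto
  qed
  from this[OF T order_refl] show ?thesis
    using memX[of T] unfolding end_T E0 E_def[of T] \<Lambda>_def by auto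
qed

text \<open>The condition \<open>lam * (1 - \<Prod>) = gam\<close> makes the displacement from \<open>xl\<close> to \<open>xb'\<close> equal to
  \<open>gam *\<^sub>R (v - x)\<close>, with \<open>v\<close> the weighted mean of the inner iterates; the term \<open>V x v\<close> then
  absorbs the quadratic error of the linearization of \<open>f\<close>.\<close>

lemma ags_step:
  assumes f: "smooth_convex_on X nrm L f gf"
    and h: "smooth_convex_on X nrm M h gh"
    and mem: "xb \<in> X" "x \<in> X" "z \<in> X"
    and lam: "0 \<le> lam" "lam \<le> 1" and T: "1 \<le> T"
    and gam: "0 \<le> gam" "gam \<le> 1" "lam * (1 - (\<Prod>i=1..T. 1 - \<alpha> i)) = gam" "L * gam \<le> \<beta> * \<nu>"
    and \<alpha>: "\<And>t. 1 \<le> t \<Longrightarrow> 0 < \<alpha> t \<and> \<alpha> t \<le> 1"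
    and pq: "\<And>t. 1 \<le> t \<Longrightarrow> lam * M * \<alpha> t \<le> \<nu> * (\<beta> * p t + q t) \<and> 0 \<le> \<beta> * p t + q t"
    and b: "\<And>t. 1 \<le> t \<Longrightarrow> b t = \<alpha> t * (\<beta> * (1 + p t) + q t)"
    and b_Suc: "\<And>t. 1 \<le> t \<Longrightarrow> \<alpha> (Suc t) * (\<beta> * p (Suc t) + q (Suc t)) = (1 - \<alpha> (Suc t)) * b t"
    and \<beta>: "0 \<le> \<beta>"
    and xl: "xl = (1 - gam) *\<^sub>R xb + gam *\<^sub>R x"
    and run: "prox_ag X h gh V \<alpha> p q (linearization f gf xl) xb x lam \<beta> T x' xt"
    and xb': "xb' = (1 - lam) *\<^sub>R xb + lam *\<^sub>R xt"
  shows "x' \<in> X" "xb' \<in> X"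
    "f xb' + h xb' - (f z + h z) \<le> (1 - gam) * (f xb + h xb - (f z + h z)) + lam * b T * (V x z - V x' z)"
proof -
  let ?g = "linearization f gf xl"
  define \<Lambda> where "\<Lambda> = (\<Prod>i=1..T. 1 - \<alpha> i)"
  have g: "?g v = (f xl - gf xl \<bullet> xl) + gf xl \<bullet> v" for v
    by (simp add: linearization_def inner_simps)
  obtain v where v: "x' \<in> X" "xt \<in> X" "v \<in> X" "xt = \<Lambda> *\<^sub>R xb + (1 - \<Lambda>) *\<^sub>R v"
    "h xb' - (1 - lam) * h xb + lam * (?g xt - ?g z - h z)
        \<le> \<Lambda> * (lam * (h xb + ?g xb - h z - ?g z)) + lam * b T * (V x z - V x' z) - lam * \<beta> * (1 - \<Lambda>) * V x v"
    using prox_ag_bound[OF h g mem lam T \<alpha> pq b b_Suc \<beta> run] unfolding \<Lambda>_def xb' by auto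
  show "x' \<in> X" by (fact v)
  show xb'X: "xb' \<in> X" unfolding xb' by (rule convex_mem_segment[OF convex_X mem(1) v(2) lam])
  have xlX: "xl \<in> X" unfolding xl by (rule convex_mem_segment[OF convex_X mem(1,2) gam(1,2)])
  have lam\<Lambda>: "lam * \<Lambda> = lam - gam" using gam(3) by (simp add: \<Lambda>_def algebra_simps)
  have \<Lambda>lam: "lam - lam * \<Lambda> = gam" by (simp add: lam\<Lambda>)
  have "xb' - xl = (1 - (lam - lam * \<Lambda>)) *\<^sub>R xb + (lam - lam * \<Lambda>) *\<^sub>R v - xl"
    by (simp add: xb' v(4) algebra_simps)
  also have "\<dots> = gam *\<^sub>R (v - x)" unfolding \<Lambda>lam by (simp add: xl algebra_simps)
  finally have diff: "xb' - xl = gam *\<^sub>R (v - x)" .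
  have "f xb' \<le> ?g xb' + L / 2 * (nrm (xb' - xl))\<^sup>2"
    using f xlX xb'X by (fastforce simp: smooth_convex_on_def)
  also have "L / 2 * (nrm (xb' - xl))\<^sup>2 = gam * ((L * gam) / 2 * (nrm (v - x))\<^sup>2)"
    unfolding diff nrm_scale by (simp add: power2_eq_square)
  also have "\<dots> \<le> gam * (\<beta> * \<nu> / 2 * (nrm (v - x))\<^sup>2)"
    using gam by (intro mult_right_mono divide_right_mono mult_left_mono) auto
  also have "\<dots> = gam * \<beta> * (\<nu> / 2 * (nrm (v - x))\<^sup>2)" by simp
  also have "\<dots> \<le> gam * \<beta> * V x v" using gam \<beta> mem v by (intro mult_left_mono V_ge) auto
  finally have 1: "f xb' \<le> ?g xb' + gam * \<beta> * V x v" by simp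
  have 2: "?g xb' = (1 - lam) * ?g xb + lam * ?g xt" by (simp add: g xb' inner_simps algebra_simps)
  have "lam * \<beta> * (1 - \<Lambda>) * V x v = (lam - lam * \<Lambda>) * (\<beta> * V x v)" by (simp add: algebra_simps)
  then have 3: "lam * \<beta> * (1 - \<Lambda>) * V x v = gam * \<beta> * V x v" by (simp only: \<Lambda>lam mult.assoc)
  have "\<Lambda> * (lam * (h xb + ?g xb - h z - ?g z)) = (lam * \<Lambda>) * (h xb + ?g xb - h z - ?g z)" by simp
  then have 4: "\<Lambda> * (lam * (h xb + ?g xb - h z - ?g z)) = (lam - gam) * (h xb + ?g xb - h z - ?g z)"
    by (simp only: lam\<Lambda>)
  have g_le: "?g y \<le> f y" if "y \<in> X" for y
    using f xlX that by (fastforce simp: smooth_convex_on_def)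
  define gb gt gz where "gb = ?g xb" and "gt = ?g xt" and "gz = ?g z"
  \<comment> \<open>The weights at \<open>xb\<close> add up to
    \<open>(1 - lam) + (lam - gam) = 1 - gam\<close>, those at \<open>z\<close> to
    \<open>gam\<close>, and the two terms in \<open>V x v\<close> cancel.\<close>
  have "f xb' + h xb' \<le> (1 - gam) * (?g xb + h xb) + gam * (?g z + h z) + lam * b T * (V x z - V x' z)"
    using v(5) 1 unfolding 2 3 4 unfolding gb_def[symmetric] gt_def[symmetric] gz_def[symmetric]
    by (simp add: algebra_simps)
  moreover have "(1 - gam) * (?g xb + h xb) \<le> (1 - gam) * (f xb + h xb)"
    using g_le mem gam by (intro mult_left_mono) auto
  moreover have "gam * (?g z + h z) \<le> gam * (f z + h z)"
    using g_le mem gam by (intro mult_left_mono) auto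
  ultimately show "f xb' + h xb' - (f z + h z)
      \<le> (1 - gam) * (f xb + h xb - (f z + h z)) + lam * b T * (V x z - V x' z)"
    by (simp add: algebra_simps)
qed

end

section \<open>Numerical bounds for the iteration counts\<close>

text \<open>With \<open>a = 1 / (p + 1)\<close>, the inequality \<open>a \<le> - ln (1 - a)\<close>
  bounds \<open>T\<close> from above, while rounding up gives
  \<open>(1 - a) ^ T \<le> 1 / 3\<close>.\<close>

lemma nat_ceiling_ln_ratio:
  fixes p :: real
  assumes p: "1 \<le> p" and T: "T = nat \<lceil>ln 3 / (- ln (1 - 1 / (p + 1)))\<rceil>"
  shows "1 \<le> T" "real T \<le> ln 3 * (p + 1) + 1" "(1 - 1 / (p + 1)) ^ T \<le> 1 / 3"
proof -
  define a where "a = 1 / (p + 1)"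
  have a: "0 < a" "a < 1" using p by (auto simp: a_def)
  have ln: "a \<le> - ln (1 - a)" using ln_add_one_self_le_self2[of "- a"] a by simp
  have l3: "0 < ln (3::real)" by simp
  have "ln 3 / (- ln (1 - a)) \<le> ln 3 / a"
    using a ln l3 by (intro divide_left_mono mult_pos_pos) auto
  also have "\<dots> = ln 3 * (p + 1)" by (simp add: a_def)
  finally have le: "ln 3 / (- ln (1 - a)) \<le> ln 3 * (p + 1)" .
  have pos: "0 < ln 3 / (- ln (1 - a))" using a ln l3 by (intro divide_pos_pos) auto
  have T': "real T = of_int \<lceil>ln 3 / (- ln (1 - a))\<rceil>" using pos by (simp add: T a_def)
  show "1 \<le> T" using pos unfolding T a_def by linarith
  show "real T \<le> ln 3 * (p + 1) + 1" using le unfolding T' by linarith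
  have "ln 3 / (- ln (1 - a)) \<le> real T" unfolding T' by simp
  moreover have "0 < - ln (1 - a)" using a ln by linarith
  ultimately have "ln 3 \<le> real T * (- ln (1 - a))" by (simp only: pos_divide_le_eq)
  then have "ln ((1 - a) ^ T) \<le> ln (1 / 3)" using a by (simp add: ln_realpow ln_div)
  then show "(1 - 1 / (p + 1)) ^ T \<le> 1 / 3" using a unfolding a_def by (subst (asm) ln_le_cancel_iff) auto
qed

lemma grad_h_evals_le:
  assumes "real (T 1) \<le> A" "\<And>k. 1 < k \<Longrightarrow> real (T k) \<le> B" "1 \<le> N"
  shows "real (grad_h_evals T N) \<le> A + (real N - 1) * B"
  using assms(3)
proof (induction N rule: nat_induct_at_least)
  case base
  then show ?case using assms(1) by (simp add: grad_h_evals_def)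
next
  case (Suc n)
  have "real (grad_h_evals T (Suc n)) = real (grad_h_evals T n) + real (T (Suc n))"
    by (simp add: grad_h_evals_def)
  then show ?case using Suc assms(2)[of "Suc n"] by (simp add: algebra_simps)
qed

text \<open>The second bound amounts to \<open>3 \<le> exp (4/3)\<close>, which the quadratic Taylor
  polynomial, with value 29/9, already shows.\<close>

lemma ln_3_bounds: "1 \<le> ln (3::real)" "3 * (1 + ln (3::real)) \<le> 7"
proof -
  show "1 \<le> ln (3::real)" using exp_le by (subst ln_ge_iff) auto
  have "3 \<le> 1 + 4/3 + (4/3)\<^sup>2 / (2::real)" by (simp add: power2_eq_square)
  also have "\<dots> \<le> exp (4/3)" by (rule exp_lower_Taylor_quadratic) simp
  finally have "ln 3 \<le> (4/3 :: real)" using ln_le_cancel_iff[of 3 "exp (4/3)"] by simp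
  then show "3 * (1 + ln (3::real)) \<le> 7" by simp
qed

section \<open>Parameter choice and complexity\<close>

text \<open>\<open>Nh\<close> tends to 0 with \<open>Nf\<close>, whereas a single outer iteration
  already costs an evaluation. Hence the general bounds use the ceiling of \<open>Nf\<close>, and
  the unrounded one is stated for \<open>Nf \<ge> 1\<close>.\<close>

theorem corollary2:
  fixes X :: "(real ^ 'n) set"
    and nrm :: "real ^ 'n \<Rightarrow> real"
    and f h :: "real ^ 'n \<Rightarrow> real"
    and gf gh :: "real ^ 'n \<Rightarrow> real ^ 'n"
    and V :: "real ^ 'n \<Rightarrow> real ^ 'n \<Rightarrow> real"
    and L M \<nu> \<epsilon> pc \<alpha>c :: real
    and \<gamma> lam \<beta> :: "nat \<Rightarrow> real"
    and T :: "nat \<Rightarrow> nat"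
    and \<alpha> p q :: "nat \<Rightarrow> nat \<Rightarrow> real"
    and x0 xstar :: "real ^ 'n"
    and x xb :: "nat \<Rightarrow> real ^ 'n"
  assumes norm: "is_norm nrm"
    and X: "closed X" "convex X"
    and L: "L > 0" and M: "M > 0" and L_le_M: "M \<ge> L"
    and f: "smooth_convex_on X nrm L f gf"
    and h: "smooth_convex_on X nrm M h gh"
    and \<nu>: "\<nu> > 0"
    and V: "prox_function X nrm \<nu> V"
    and \<epsilon>: "\<epsilon> > 0"
    and xstar: "is_arg_min (\<lambda>y. f y + h y) (\<lambda>y. y \<in> X) xstar"
    and x0: "x0 \<in> X"
    and pc: "pc = sqrt (M / L)"
    and \<alpha>c: "\<alpha>c = 1 / (pc + 1)"
    and \<alpha>_first: "\<And>t. t \<ge> 1 \<Longrightarrow> \<alpha> 1 t = 2 / (real t + 1)"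
    and p_first: "\<And>t. t \<ge> 1 \<Longrightarrow> p 1 t = (real t - 1) / 2"
    and q_first: "\<And>t. t \<ge> 1 \<Longrightarrow>
                    q 1 t = 7 * L * real (T 1) * (real (T 1) + 1) / (4 * \<nu> * real t)"
    and p_later: "\<And>k t. k > 1 \<Longrightarrow> t \<ge> 1 \<Longrightarrow> p k t = pc"
    and \<alpha>_later: "\<And>k t. k > 1 \<Longrightarrow> t \<ge> 1 \<Longrightarrow> \<alpha> k t = \<alpha>c"
    and q_later: "\<And>k t. k > 1 \<Longrightarrow> t \<ge> 1 \<Longrightarrow> q k t = 0"
    and \<gamma>: "\<And>k. k \<ge> 1 \<Longrightarrow> \<gamma> k = 2 / (real k + 1)"
    and T_first: "T 1 = nat \<lceil>sqrt (8 * M / (7 * L))\<rceil>"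
    and T_later: "\<And>k. k > 1 \<Longrightarrow> T k = nat \<lceil>ln 3 / (- ln (1 - \<alpha>c))\<rceil>"
    and lam_first: "lam 1 = 1"
    and lam_later: "\<And>k. k > 1 \<Longrightarrow> lam k = \<gamma> k / (1 - (1 - \<alpha>c) ^ T k)"
    and \<beta>_first: "\<beta> 1 = L / \<nu>"
    and \<beta>_later: "\<And>k. k > 1 \<Longrightarrow> \<beta> k = 9 * L * \<gamma> k / (2 * \<nu> * real k * lam k)"
    and run: "ags_run X f gf h gh V \<gamma> lam \<beta> T \<alpha> p q x0 x xb"
  shows "let Nf = 3 * sqrt (L * V x0 xstar / (\<nu> * \<epsilon>));
             Nh = (1 + ln 3) * Nf * (sqrt (M / L) + 1)
         in (\<exists>N. eps_solution X (\<lambda>y. f y + h y) \<epsilon> (xb N) \<and>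
                 int (grad_f_evals N) \<le> \<lceil>Nf\<rceil> \<and>
                 real (grad_h_evals T N)
                   \<le> (1 + ln 3) * of_int \<lceil>Nf\<rceil> * (sqrt (M / L) + 1) \<and>
                 (Nf \<ge> 1 \<longrightarrow> real (grad_h_evals T N) \<le> Nh)) \<and>
            Nh \<le> 7 * (sqrt (M * V x0 xstar / (\<nu> * \<epsilon>)) + sqrt (L * V x0 xstar / (\<nu> * \<epsilon>)))"
proof -
  let ?\<phi> = "\<lambda>y. f y + h y"
  define C where "C = 9 * L / (2 * \<nu>)"
  obtain w gw where "bregman X nrm \<nu> w gw V"
    using V X(2) norm \<nu> by (auto simp: prox_function_def bregman_def)
  then interpret bregman X nrm \<nu> w gw V .
  have xsX: "xstar \<in> X" and xs_min: "\<And>y. y \<in> X \<Longrightarrow> ?\<phi> xstar \<le> ?\<phi> y"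
    using xstar by (auto simp: is_arg_min_linorder)
  have pc1: "1 \<le> pc" using L L_le_M by (simp add: pc)
  have Mpc: "M = L * pc\<^sup>2" using L M by (simp add: pc)
  have \<alpha>c01: "0 < \<alpha>c" "\<alpha>c \<le> 1" "\<alpha>c * (1 + pc) = 1" "\<alpha>c * pc = 1 - \<alpha>c" using pc1 by (auto simp: \<alpha>c field_simps)
  have T1: "1 \<le> T 1" "real (T 1) \<le> 11 / 10 * pc + 1" "8 * M \<le> 7 * L * (real (T 1))\<^sup>2"
  proof -
    let ?s = "sqrt (8 * M / (7 * L))"
    have s: "0 < ?s" using L M by simp
    then have T1r: "real (T 1) = of_int \<lceil>?s\<rceil>" unfolding T_first by simp
    show "1 \<le> T 1" using s unfolding T_first by linarith
    \<comment> \<open>The constant comes from \<open>8 / 7 \<le> (11 / 10)\<^sup>2\<close>.\<close>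
    have "?s \<le> sqrt ((11 / 10 * pc)\<^sup>2)"
      using L by (intro real_sqrt_le_mono) (simp add: Mpc power_mult_distrib, simp add: power2_eq_square)
    then have "?s \<le> 11 / 10 * pc" using pc1 by simp
    then show "real (T 1) \<le> 11 / 10 * pc + 1" unfolding T1r by linarith
    have "?s \<le> real (T 1)" unfolding T1r by simp
    then have "?s\<^sup>2 \<le> (real (T 1))\<^sup>2" using s by (intro power_mono) auto
    then show "8 * M \<le> 7 * L * (real (T 1))\<^sup>2" using L M by (simp add: field_simps)
  qed
  note Tk = nat_ceiling_ln_ratio[OF pc1 T_later[unfolded \<alpha>c], folded \<alpha>c]

  \<comment> \<open>Decrease of the potential in one outer iteration\<close>
  have step: "x k \<in> X \<and> xb k \<in> X \<and> real k * (real k + 1) / 2 * (?\<phi> (xb k) - ?\<phi> xstar) + C * V (x k) xstar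
      \<le> real (k - 1) * (real (k - 1) + 1) / 2 * (?\<phi> (xb (k - 1)) - ?\<phi> xstar) + C * V (x (k - 1)) xstar"
    if k: "1 \<le> k" and mem: "x (k - 1) \<in> X" "xb (k - 1) \<in> X" for k
  proof -
    obtain xt where pr: "prox_ag X h gh V (\<alpha> k) (p k) (q k)
        (linearization f gf ((1 - \<gamma> k) *\<^sub>R xb (k - 1) + \<gamma> k *\<^sub>R x (k - 1)))
        (xb (k - 1)) (x (k - 1)) (lam k) (\<beta> k) (T k) (x k) xt"
      and xbk: "xb k = (1 - lam k) *\<^sub>R xb (k - 1) + lam k *\<^sub>R xt"
      using run k unfolding ags_run_def Let_def by blast
    define b where "b t = \<alpha> k t * (\<beta> k * (1 + p k t) + q k t)" for t
    have \<gamma>k: "0 \<le> \<gamma> k" "\<gamma> k \<le> 1" using k by (auto simp: \<gamma>)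
    \<comment> \<open>The hypotheses of \<open>ags_step\<close>, together with the normalization
      that makes the weighted coefficient of the outer distances equal to \<open>C\<close> for every
      \<open>k\<close>.\<close>
    have *: "0 \<le> lam k \<and> lam k \<le> 1 \<and> 1 \<le> T k \<and> lam k * (1 - (\<Prod>i=1..T k. 1 - \<alpha> k i)) = \<gamma> k
        \<and> L * \<gamma> k \<le> \<beta> k * \<nu> \<and> 0 \<le> \<beta> k \<and> real k * (real k + 1) / 2 * (lam k * b (T k)) = C \<and>
        (\<forall>t\<ge>1. 0 < \<alpha> k t \<and> \<alpha> k t \<le> 1 \<and> 0 \<le> \<beta> k * p k t + q k t \<and>
          lam k * M * \<alpha> k t \<le> \<nu> * (\<beta> k * p k t + q k t) \<and>
          \<alpha> k (Suc t) * (\<beta> k * p k (Suc t) + q k (Suc t)) = (1 - \<alpha> k (Suc t)) * b t)"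
    proof (cases "k = 1")
      case True
      define T1 where "T1 = real (T 1)"
      have T1_ge: "1 \<le> T1" "8 * M \<le> 7 * L * T1\<^sup>2" using T1 by (auto simp: T1_def)
      \<comment> \<open>The factor at \<open>i = 1\<close> vanishes because
        \<open>\<alpha> 1 1 = 1\<close>; this matches \<open>lam 1 = \<gamma> 1 = 1\<close>.\<close>
      have prod: "(\<Prod>i=1..T 1. 1 - \<alpha> 1 i) = 0"
        using T1(1) \<alpha>_first[of 1] by (intro prod_zero) auto
      \<comment> \<open>The prox part contributes \<open>L / \<nu>\<close> and \<open>q\<close>
        contributes \<open>7 * L / (2 * \<nu>)\<close>, together
        \<open>9 * L / (2 * \<nu>)\<close>.\<close>
      have bT: "b (T 1) = C"
        using T1(1) T1_ge \<nu> unfolding b_def True \<alpha>_first[OF T1(1)] p_first[OF T1(1)] q_first[OF T1(1)] \<beta>_first C_def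
          T1_def[symmetric] by (simp add: divide_simps) (simp add: algebra_simps)
      have "0 < \<alpha> 1 t \<and> \<alpha> 1 t \<le> 1 \<and> 0 \<le> \<beta> 1 * p 1 t + q 1 t \<and>
          1 * M * \<alpha> 1 t \<le> \<nu> * (\<beta> 1 * p 1 t + q 1 t) \<and>
          \<alpha> 1 (Suc t) * (\<beta> 1 * p 1 (Suc t) + q 1 (Suc t)) = (1 - \<alpha> 1 (Suc t)) * b t" if t: "1 \<le> t" for t
      proof (intro conjI)
        define s where "s = real t"
        have s: "1 \<le> s" using t by (simp add: s_def)
        note par = \<alpha>_first[OF t] p_first[OF t] q_first[OF t] \<beta>_first s_def[symmetric] T1_def[symmetric]
        have t': "1 \<le> Suc t" by simp
        have St: "real (Suc t) = s + 1" by (simp add: s_def)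
        note par' = \<alpha>_first[OF t'] p_first[OF t'] q_first[OF t'] St
        show "0 < \<alpha> 1 t" "\<alpha> 1 t \<le> 1" using s unfolding par by auto
        show "0 \<le> \<beta> 1 * p 1 t + q 1 t"
          using s T1_ge L \<nu> unfolding par by (intro add_nonneg_nonneg mult_nonneg_nonneg divide_nonneg_nonneg) auto
        have "1 * M * \<alpha> 1 t \<le> 2 * M / s" using s M unfolding par by (simp add: field_simps)
        also have "\<dots> = 8 * M / (4 * s)" by simp
        also have "\<dots> \<le> 7 * L * T1 * (T1 + 1) / (4 * s)"
        proof -
          have "7 * L * T1\<^sup>2 \<le> 7 * L * T1 * (T1 + 1)" using L T1_ge by (simp add: power2_eq_square)
          then show ?thesis using T1_ge s by (intro divide_right_mono) auto
        qed
        also have "\<dots> \<le> L * ((s - 1) / 2) + 7 * L * T1 * (T1 + 1) / (4 * s)" using L s by simp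
        also have "\<dots> = \<nu> * (\<beta> 1 * p 1 t + q 1 t)" using \<nu> s unfolding par by (simp add: field_simps)
        finally show "1 * M * \<alpha> 1 t \<le> \<nu> * (\<beta> 1 * p 1 t + q 1 t)" .
        \<comment> \<open>With \<open>Q\<close> the numerator of \<open>q 1 t\<close>, i.e.
          \<open>q 1 t = Q / s\<close>, both sides equal
          \<open>2 / (s + 2) * (L * s / (2 * \<nu>) + Q / (s + 1))\<close>.\<close>
        show "\<alpha> 1 (Suc t) * (\<beta> 1 * p 1 (Suc t) + q 1 (Suc t)) = (1 - \<alpha> 1 (Suc t)) * b t"
          using s \<nu> unfolding b_def True par par' by (simp add: divide_simps)
      qed
      moreover have "\<gamma> 1 = 1" by (simp add: \<gamma>)
      ultimately show ?thesis
        using True T1(1) lam_first prod bT L \<nu> by (simp add: \<beta>_first[simplified])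
    next
      case False
      then have k1: "1 < k" using k by simp
      define K where "K = real k"
      have K: "2 \<le> K" using k1 by (simp add: K_def)
      have gk: "\<gamma> k = 2 / (K + 1)" using k by (simp add: \<gamma> K_def)
      have gpos: "0 < \<gamma> k" using K by (simp add: gk)
      have prod: "(\<Prod>i=1..T k. 1 - \<alpha> k i) = (1 - \<alpha>c) ^ T k" by (simp add: \<alpha>_later[OF k1])
      define r where "r = 1 - (1 - \<alpha>c) ^ T k"
      \<comment> \<open>The \<open>ln 3\<close> in \<open>T k\<close> is chosen for this: it gives
        \<open>lam k \<le> 3 / 2 * \<gamma> k\<close>, and the right-hand side equals 1 at
        \<open>k = 2\<close>, so \<open>lam k \<le> 1\<close> for all later calls.\<close>
      have r: "2 / 3 \<le> r" using Tk(3)[OF k1] by (simp add: r_def)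
      have lamk: "lam k = \<gamma> k / r" by (simp add: lam_later[OF k1] r_def)
      have lam_pos: "0 < lam k" using gpos r by (simp add: lamk)
      have "\<gamma> k / r \<le> \<gamma> k / (2 / 3)" using gpos r by (intro divide_left_mono) auto
      then have lam_le: "lam k \<le> 3 / 2 * \<gamma> k" by (simp add: lamk)
      have "3 / 2 * \<gamma> k \<le> 1" "K * (3 / 2 * \<gamma> k) \<le> 3" using K by (auto simp: gk field_simps)
      then have lam1: "lam k \<le> 1" and Klam: "K * lam k \<le> 3"
        using lam_le mult_left_mono[OF lam_le, of K] K by linarith+
      have \<beta>k: "\<beta> k = 9 * L * \<gamma> k / (2 * \<nu> * K * lam k)" by (simp add: \<beta>_later[OF k1] K_def)
      have \<beta>pos: "0 < \<beta> k" using L \<nu> gpos lam_pos K by (simp add: \<beta>k)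
      \<comment> \<open>The weights stay constant since \<open>\<alpha>c * (1 + pc) = 1\<close>; the
        recursion for \<open>b\<close> is then
        \<open>\<alpha>c * pc = 1 - \<alpha>c\<close>.\<close>
      have b: "b t = \<beta> k" if "1 \<le> t" for t
        using \<alpha>c01(3) by (simp add: b_def \<alpha>_later[OF k1 that] p_later[OF k1 that] q_later[OF k1 that])
      have \<nu>\<beta>: "\<nu> * \<beta> k * (K * lam k) = 9 / 2 * (L * \<gamma> k)" using \<nu> K lam_pos by (simp add: \<beta>k)
      have 1: "L * \<gamma> k \<le> \<beta> k * \<nu>"
      proof -
        have "\<nu> * \<beta> k * (K * lam k) \<le> \<nu> * \<beta> k * (9 / 2)"
          using Klam \<nu> \<beta>pos by (intro mult_left_mono) auto
        then show ?thesis unfolding \<nu>\<beta> by (simp add: mult.commute)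
      qed
      have 2: "K * (K + 1) / 2 * (lam k * \<beta> k) = C"
        using K \<nu> lam_pos gpos unfolding \<beta>k C_def by (simp add: gk)
      have 3: "lam k * M * \<alpha>c \<le> \<nu> * (\<beta> k * pc)"
      proof -
        \<comment> \<open>Multiplying by \<open>K * lam k\<close> allows
          \<open>K * lam k \<le> 3\<close> and \<open>lam k \<le> 3 / 2 * \<gamma> k\<close> to be
          used; their product of constants is the \<open>9 / 2\<close> of
          \<open>\<nu>\<beta>\<close>.\<close>
        have "lam k * M * \<alpha>c * (K * lam k) = (K * lam k) * lam k * (L * pc * (\<alpha>c * pc))"
          by (simp add: Mpc power2_eq_square)
        also have "\<dots> \<le> 3 * (3 / 2 * \<gamma> k) * (L * pc * 1)"
          using Klam lam_le lam_pos K L pc1 \<alpha>c01 gpos by (intro mult_mono) auto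
        also have "\<dots> = \<nu> * (\<beta> k * pc) * (K * lam k)" using \<nu>\<beta> by (simp add: algebra_simps)
        finally show ?thesis using K lam_pos by (simp add: mult_le_cancel_right)
      qed
      show ?thesis
        using lam_pos lam1 Tk(1)[OF k1] 1 2 3 \<beta>pos \<alpha>c01 pc1 r
        by (simp add: prod b \<alpha>_later[OF k1] p_later[OF k1] q_later[OF k1] K_def[symmetric] r_def[symmetric] lamk mult.left_commute)
    qed
    have "x k \<in> X" "xb k \<in> X" and
      le: "?\<phi> (xb k) - ?\<phi> xstar \<le> (1 - \<gamma> k) * (?\<phi> (xb (k - 1)) - ?\<phi> xstar)
        + lam k * b (T k) * (V (x (k - 1)) xstar - V (x k) xstar)"
      using ags_step[OF f h mem(2,1) xsX _ _ _ \<gamma>k _ _ _ _ _ _ _ refl pr xbk, of b] * b_def by blast+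
    define c where "c = real k * (real k + 1) / 2"
    define d where "d = ?\<phi> (xb (k - 1)) - ?\<phi> xstar"
    \<comment> \<open>Contracting the weight \<open>k * (k + 1) / 2\<close> by
      \<open>1 - \<gamma> k = (k - 1) / (k + 1)\<close> gives the weight of index
      \<open>k - 1\<close>.\<close>
    have c: "0 \<le> c" "c * (1 - \<gamma> k) = real (k - 1) * (real (k - 1) + 1) / 2"
      using k by (auto simp: c_def \<gamma> of_nat_diff field_simps)
    have C: "c * (lam k * b (T k)) = C" using * by (simp add: c_def)
    have "c * (?\<phi> (xb k) - ?\<phi> xstar) \<le> c * ((1 - \<gamma> k) * d
        + lam k * b (T k) * (V (x (k - 1)) xstar - V (x k) xstar))"
      using le c(1) unfolding d_def by (rule mult_left_mono)
    also have "\<dots> = c * (1 - \<gamma> k) * d + c * (lam k * b (T k)) * (V (x (k - 1)) xstar - V (x k) xstar)"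
      by (simp only: distrib_left mult.assoc)
    also have "\<dots> = real (k - 1) * (real (k - 1) + 1) / 2 * d + C * (V (x (k - 1)) xstar - V (x k) xstar)"
      unfolding c(2) C ..
    finally show ?thesis using \<open>x k \<in> X\<close> \<open>xb k \<in> X\<close> by (simp add: c_def d_def right_diff_distrib)
  qed
  have x_init: "x 0 = x0" "xb 0 = x0" using run by (auto simp: ags_run_def)
  have inv: "x k \<in> X \<and> xb k \<in> X \<and> real k * (real k + 1) / 2 * (?\<phi> (xb k) - ?\<phi> xstar) + C * V (x k) xstar
      \<le> C * V x0 xstar" for k
  proof (induction k)
    case 0
    then show ?case using x0 x_init by simp
  next
    case (Suc k)
    then show ?case using step[of "Suc k"] by auto
  qed

  \<comment> \<open>The stopping index and its accuracy\<close>
  define Nf where "Nf = 3 * sqrt (L * V x0 xstar / (\<nu> * \<epsilon>))"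
  have V0: "0 \<le> V x0 xstar" by (rule V_nonneg[OF x0 xsX])
  have Nf0: "0 \<le> Nf" using V0 L \<nu> \<epsilon> by (simp add: Nf_def)
  have Nf2: "Nf\<^sup>2 * \<epsilon> = 2 * (C * V x0 xstar)"
    using V0 L \<nu> \<epsilon> by (simp add: Nf_def C_def power_mult_distrib)
  \<comment> \<open>Using \<open>N * (N + 1)\<close> instead of a square, and taking the least
    index, gives the sharp estimate \<open>(N - 1) * N < Nf\<^sup>2\<close> needed for the unrounded
    bound. The index is 0 exactly when \<open>Nf = 0\<close>.\<close>
  define N where "N = (LEAST N. Nf\<^sup>2 \<le> real N * (real N + 1))"
  have "Nf\<^sup>2 \<le> real (nat \<lceil>Nf\<rceil>) * (real (nat \<lceil>Nf\<rceil>) + 1)"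
    unfolding power2_eq_square using Nf0 by (intro mult_mono) linarith+
  then have N: "Nf\<^sup>2 \<le> real N * (real N + 1)" unfolding N_def by (rule LeastI)
  have N_least: "(real N - 1) * real N < Nf\<^sup>2" if "1 \<le> N"
    using not_less_Least[of "N - 1" "\<lambda>N. Nf\<^sup>2 \<le> real N * (real N + 1)"] that
    unfolding N_def[symmetric] by (simp add: of_nat_diff not_le)
  have Nf_gt: "real N - 1 < Nf" if "1 \<le> N"
  proof (rule power2_less_imp_less[OF le_less_trans[OF _ N_least[OF that]] Nf0])
    show "(real N - 1)\<^sup>2 \<le> (real N - 1) * real N" using that by (simp add: power2_eq_square mult_left_mono)
  qed
  have N_le: "int N \<le> \<lceil>Nf\<rceil>"
    using Nf_gt Nf0 by (cases "1 \<le> N") linarith+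
  have opt: "?\<phi> (xb N) - ?\<phi> xstar \<le> \<epsilon>"
  proof (cases "N = 0")
    \<comment> \<open>No iteration is made: \<open>V x0 xstar = 0\<close> forces
      \<open>x0 = xstar\<close>.\<close>
    case True
    then have "Nf\<^sup>2 * \<epsilon> \<le> 0" using N \<epsilon> by simp
    then have "C * V x0 xstar \<le> 0" using Nf2 by simp
    moreover have "0 < C" using L \<nu> by (simp add: C_def)
    ultimately have "V x0 xstar = 0" using V0 by (simp add: mult_le_0_iff)
    then show ?thesis using V_eq_0_D[OF x0 xsX] True x_init \<epsilon> by simp
  next
    case False
    have "0 \<le> C * V (x N) xstar" using inv[of N] V_nonneg xsX L \<nu> by (simp add: C_def)
    then have "real N * (real N + 1) / 2 * (?\<phi> (xb N) - ?\<phi> xstar) \<le> C * V x0 xstar"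
      using inv[of N, THEN conjunct2, THEN conjunct2] by (rule order_trans[OF le_add_same_cancel1[THEN iffD2]])
    then have "real N * (real N + 1) * (?\<phi> (xb N) - ?\<phi> xstar) \<le> Nf\<^sup>2 * \<epsilon>" unfolding Nf2 by simp
    also have "\<dots> \<le> real N * (real N + 1) * \<epsilon>" using N \<epsilon> by simp
    finally show ?thesis using False by (simp add: mult_le_cancel_left)
  qed
  have "(INF y\<in>X. ?\<phi> y) = ?\<phi> xstar"
    using xsX xs_min by (intro cInf_eq_minimum) auto
  then have eps: "eps_solution X ?\<phi> \<epsilon> (xb N)"
    using opt inv[of N] by (simp add: eps_solution_def)

  \<comment> \<open>Counting evaluations of the gradient of \<open>h\<close>\<close>
  define l :: real where "l = ln 3"
  have l: "1 \<le> l" "3 * (1 + l) \<le> 7" unfolding l_def by (rule ln_3_bounds)+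
  \<comment> \<open>The budget per outer iteration. The first call stays within it, and every later
    call leaves \<open>pc\<close> of it unspent.\<close>
  define m where "m = (1 + l) * (pc + 1)"
  have m: "2 * (pc + 1) \<le> m" unfolding m_def using l pc1 by (intro mult_right_mono) auto
  have T1_le: "real (T 1) \<le> m"
    using T1(2) m pc1 by simp
  have Tk_le: "real (T k) \<le> m - pc" if "1 < k" for k
    using Tk(2)[OF that] by (simp add: m_def l_def algebra_simps)
  have evals: "real (grad_h_evals T N) \<le> (1 + l) * real N * (pc + 1)"
  proof (cases "1 \<le> N")
    case True
    have "real (grad_h_evals T N) \<le> m + (real N - 1) * m"
      using Tk_le pc1 by (intro grad_h_evals_le[where T = T, OF T1_le _ True]) force
    then show ?thesis by (simp add: m_def algebra_simps)
  qed (use l pc1 in \<open>simp add: grad_h_evals_def not_le\<close>)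
  have evals_ceil: "real (grad_h_evals T N) \<le> (1 + l) * of_int \<lceil>Nf\<rceil> * (pc + 1)"
  proof -
    have "real N \<le> of_int \<lceil>Nf\<rceil>" using N_le by linarith
    then have "(1 + l) * real N * (pc + 1) \<le> (1 + l) * of_int \<lceil>Nf\<rceil> * (pc + 1)"
      using l pc1 by (intro mult_right_mono mult_left_mono) auto
    then show ?thesis using evals by linarith
  qed
  \<comment> \<open>\<open>N\<close> may exceed \<open>Nf\<close>, but when \<open>N \<ge> 2\<close> at most by \<open>3/5\<close>, as
    \<open>Nf\<^sup>2 > (N - 1) * N \<ge> (N - 1 + 2/5)\<^sup>2\<close>. The bounds on \<open>T k\<close> leave enough room for that surplus.\<close>
  have evals_Nf: "real (grad_h_evals T N) \<le> (1 + l) * Nf * (pc + 1)" if "1 \<le> Nf"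
  proof (cases "N \<le> 1")
    case True
    \<comment> \<open>Here \<open>1 \<le> Nf\<close> enters: it gives \<open>N \<le> Nf\<close>
      directly.\<close>
    then have "(1 + l) * real N * (pc + 1) \<le> (1 + l) * Nf * (pc + 1)"
      using l pc1 that by (intro mult_right_mono mult_left_mono) auto
    then show ?thesis using evals by linarith
  next
    case False
    define n where "n = real N - 1"
    have n: "1 \<le> n" using False by (simp add: n_def)
    have "(n + 2 / 5)\<^sup>2 < Nf\<^sup>2"
      using N_least False n by (simp add: n_def power2_eq_square algebra_simps)
    then have "n + 2 / 5 \<le> Nf" using power2_less_imp_less[OF _ Nf0] by force
    then have "(n + 2 / 5) * m \<le> Nf * m" using m pc1 by (intro mult_right_mono) auto
    moreover have "real (grad_h_evals T N) \<le> 11 / 10 * pc + 1 + n * (m - pc)"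
      unfolding n_def using False by (intro grad_h_evals_le[where T = T, OF T1(2) Tk_le]) auto
    \<comment> \<open>The saving of one later call is set against the first call. What remains is at
      most \<open>pc / 10 + 1\<close>, which \<open>2 / 5 * m \<ge> 4 / 5 * (pc + 1)\<close> covers
      as \<open>pc \<ge> 1\<close>.\<close>
    moreover have "pc \<le> n * pc" using mult_right_mono[of 1 n pc] n pc1 by simp
    moreover have "11 / 10 * pc + 1 - pc \<le> 2 / 5 * m" using m pc1 by simp
    ultimately have "real (grad_h_evals T N) \<le> Nf * m"
      unfolding distrib_right right_diff_distrib by argo
    then show ?thesis by (simp add: m_def mult.commute mult.left_commute)
  qed
  have "(1 + l) * Nf * (pc + 1) = 3 * (1 + l) * (sqrt (L * V x0 xstar / (\<nu> * \<epsilon>)) * (pc + 1))"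
    by (simp only: Nf_def mult_ac)
  also have "\<dots> \<le> 7 * (sqrt (L * V x0 xstar / (\<nu> * \<epsilon>)) * (pc + 1))"
    using l V0 L \<nu> \<epsilon> pc1 by (intro mult_right_mono) auto
  also have "sqrt (L * V x0 xstar / (\<nu> * \<epsilon>)) * (pc + 1)
      = sqrt (M * V x0 xstar / (\<nu> * \<epsilon>)) + sqrt (L * V x0 xstar / (\<nu> * \<epsilon>))"
    using L by (simp add: pc distrib_left flip: real_sqrt_mult)
  finally have "(1 + l) * Nf * (pc + 1)
      \<le> 7 * (sqrt (M * V x0 xstar / (\<nu> * \<epsilon>)) + sqrt (L * V x0 xstar / (\<nu> * \<epsilon>)))" .
  moreover have "int (grad_f_evals N) \<le> \<lceil>Nf\<rceil>" using N_le by (simp add: grad_f_evals_def)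
  ultimately show ?thesis
    using eps evals_ceil evals_Nf unfolding Let_def Nf_def l_def pc by blast
qed

end
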